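(* Consider the $M[pqrs]$ random walk on $\{0,1,\dots,N\}$ described in the context, started in $i_0$ with $0<M<i_0<N$. Then the expected number of arrivals (visits) $x_n=\sum_{k=0}^\infty p_{i_0,n}^{(k)}$ in state $n$ is $$x_n=\begin{cases} \dfrac{p_2q_M\varphi_0}{p_0q_2\varphi_M}\,x_M&(n=0)\\[2ex] \dfrac{q_M\varphi_n}{q_2\varphi_M}\,x_M&(1\le n\le M-1)\\[2ex] \dfrac{\lambda_1\left[\frac{q_1}{p_1}\right]^{i_0}}{\gamma_1\mu_2-\gamma_2\mu_1}&(n=M)\\[2ex] \dfrac{\left[\frac{q_1}{p_1}\right]^{i_0}\left(\mu_1\xi_1^n-\mu_2\xi_2^n\right)}{\gamma_1\mu_2-\gamma_2\mu_1}&(M+1\le n\le i_0)\\[2ex] \beta_n\,x_{i_0}&(i_0\le n\le N-1)\\[1ex] \dfrac{q_1}{q_N}\,\beta_N\,x_{i_0}&(n=N). \end{cases}$$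
   Context: The walk: for $i=1,2$ let $p_i,q_i>0$, $r_i,s_i\ge0$, $p_i+q_i+r_i+s_i=1$. In each state $n$ with $0<n<M$, at each time step the particle moves to $n+1$ with probability $p_2$, moves to $n-1$ with probability $q_2$, stays with probability $r_2$, or is absorbed in $n$ (removed) with probability $s_2$. In each state $n$ with $M<n<N$ the corresponding probabilities are $p_1,q_1,r_1,s_1$. In the states $0,M,N$ the corresponding probabilities are specific probabilities $(p_0,q_0,r_0,s_0)$, $(p_M,q_M,r_M,s_M)$, $(p_N,q_N,r_N,s_N)$, each quadruple summing to $1$, with $q_0=0$ and $p_N=0$. (The subscripts $0,M,N$ are labels of these special states and are distinct from the labels $1,2$ of the two regions, whatever the numerical values of $M,N$.) Here $p_{i,j}^{(k)}$ is the probability that the particle, starting in $i$ at time $0$, has not been absorbed and is in state $j$ after $k$ steps (so $p_{i,j}^{(0)}=\delta(i,j)$). Notation ($i=1,2$): $$\lambda_i=\sqrt{(1-r_i)^2-4p_iq_i},$$ $$\eta_1=\frac{(1-r_2)+\lambda_2}{2q_2},\quad \eta_2=\frac{(1-r_2)-\lambda_2}{2q_2},\quad \xi_1=\frac{(1-r_1)+\lambda_1}{2q_1},\quad \xi_2=\frac{(1-r_1)-\lambda_1}{2q_1},$$ $$t_i=p_2(1-r_0)-p_0q_2\eta_i,\quad t=\frac{t_1}{t_2},\qquad u_i=\xi_i^{N-1}\left[q_1(1-r_N)\xi_i-p_1q_N\right],\quad u=\frac{u_1}{u_2},$$ $$\varphi_n=\eta_1^n-t\,\eta_2^n,\qquad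 \beta_n=\frac{\xi_1^n-u\,\xi_2^n}{\xi_1^{i_0}-u\,\xi_2^{i_0}},$$ $$\gamma_i=\xi_i^{-i_0}\left[r_1-1+q_1(\beta_{i_0+1}+\xi_i)\right],\qquad \mu_i=\xi_i^{-M}\left[1-r_M-p_M\xi_i^{-1}-\frac{p_2q_M\varphi_{M-1}}{q_2\varphi_M}\right].$$
   Formalization: The formulas are asserted only where their divisors are nonzero: t_2, u_2, φ_M, the denominator of β_n and γ_1μ_2−γ_2μ_1 throughout, p_0 for the line n=0, q_N for the line n=N; otherwise they are undefined (e.g. t_2=0 if s_0=s_2=0 and p_2≤q_2). *)

theory Defs
  imports "HOL-Probability.Probability"
begin

text \<open>
  The five kinds of states carrying their own transition probabilities: the special states
  \<open>0\<close>, \<open>M\<close>, \<open>N\<close> are labelled \<open>S0\<close>, \<open>SM\<close>, \<open>SN\<close>; the region between \<open>M\<close> and \<open>N\<close> is labelled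
  \<open>S1\<close>, and the region between \<open>0\<close> and \<open>M\<close> is labelled \<open>S2\<close>.
\<close>
datatype site = S0 | S1 | S2 | SM | SN

text \<open>
  \<open>pr\<close>, \<open>qr\<close>, \<open>rr\<close>, \<open>sr\<close> are the probabilities of a step up, a step down, staying, and being
  absorbed; \<open>posM\<close> and \<open>posN\<close> are the positions \<open>M\<close> and \<open>N\<close>.
\<close>
record mpqrs =
  pr :: "site \<Rightarrow> real"
  qr :: "site \<Rightarrow> real"
  rr :: "site \<Rightarrow> real"
  sr :: "site \<Rightarrow> real"
  posM :: nat
  posN :: nat

definition is_mpqrs :: "mpqrs \<Rightarrow> bool" where
  "is_mpqrs W \<longleftrightarrow>
     0 < posM W \<and> posM W < posN W \<and>
     (\<forall>a. 0 \<le> pr W a \<and> 0 \<le> qr W a \<and> 0 \<le> rr W a \<and> 0 \<le> sr W a) \<and>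
     (\<forall>a. pr W a + qr W a + rr W a + sr W a = 1) \<and>
     (\<forall>a\<in>{S1, S2}. 0 < pr W a \<and> 0 < qr W a) \<and>
     qr W S0 = 0 \<and> pr W SN = 0"

definition site_of :: "mpqrs \<Rightarrow> nat \<Rightarrow> site" where
  "site_of W n =
     (if n = 0 then S0 else if n < posM W then S2 else if n = posM W then SM
      else if n < posN W then S1 else SN)"

text \<open>
  The position of the particle is \<open>Some n\<close> while it is alive and \<open>None\<close> once it has been absorbed.
  The truncated subtraction at \<open>n = 0\<close> and the state \<open>posN W + 1\<close> are harmless, because a step down
  from \<open>0\<close> and a step up from \<open>N\<close> have probability \<open>0\<close>.
\<close>
definition walk_step :: "mpqrs \<Rightarrow> nat \<Rightarrow> nat option pmf" where
  "walk_step W n =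
     (let a = site_of W n in
      pmf_of_list [(Some (n + 1), pr W a), (Some (n - 1), qr W a), (Some n, rr W a), (None, sr W a)])"

primrec walk :: "mpqrs \<Rightarrow> nat \<Rightarrow> nat \<Rightarrow> nat option pmf" where
  "walk W i 0 = return_pmf (Some i)"
| "walk W i (Suc k) =
     bind_pmf (walk W i k) (\<lambda>x. case x of None \<Rightarrow> return_pmf None | Some n \<Rightarrow> walk_step W n)"

definition kprob :: "mpqrs \<Rightarrow> nat \<Rightarrow> nat \<Rightarrow> nat \<Rightarrow> real" where
  "kprob W k i j = pmf (walk W i k) (Some j)"

definition visits :: "mpqrs \<Rightarrow> nat \<Rightarrow> nat \<Rightarrow> real" where
  "visits W i n = (\<Sum>k. kprob W k i n)"

definition lam :: "mpqrs \<Rightarrow> site \<Rightarrow> real" where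
  "lam W a = sqrt ((1 - rr W a)^2 - 4 * pr W a * qr W a)"

text \<open>In \<open>eta\<close>, \<open>xi\<close>, \<open>tt\<close>, \<open>uu\<close>, \<open>gam\<close>, \<open>mu\<close> the index \<open>i\<close> is meant to be \<open>1\<close> or \<open>2\<close>.\<close>

definition eta :: "mpqrs \<Rightarrow> nat \<Rightarrow> real" where
  "eta W i = (if i = 1 then ((1 - rr W S2) + lam W S2) / (2 * qr W S2)
              else ((1 - rr W S2) - lam W S2) / (2 * qr W S2))"

definition xi :: "mpqrs \<Rightarrow> nat \<Rightarrow> real" where
  "xi W i = (if i = 1 then ((1 - rr W S1) + lam W S1) / (2 * qr W S1)
             else ((1 - rr W S1) - lam W S1) / (2 * qr W S1))"

definition tt :: "mpqrs \<Rightarrow> nat \<Rightarrow> real" where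
  "tt W i = pr W S2 * (1 - rr W S0) - pr W S0 * qr W S2 * eta W i"

definition uu :: "mpqrs \<Rightarrow> nat \<Rightarrow> real" where
  "uu W i = xi W i ^ (posN W - 1) * (qr W S1 * (1 - rr W SN) * xi W i - pr W S1 * qr W SN)"

definition t_ratio :: "mpqrs \<Rightarrow> real" where
  "t_ratio W = tt W 1 / tt W 2"

definition u_ratio :: "mpqrs \<Rightarrow> real" where
  "u_ratio W = uu W 1 / uu W 2"

definition phi :: "mpqrs \<Rightarrow> nat \<Rightarrow> real" where
  "phi W n = eta W 1 ^ n - t_ratio W * eta W 2 ^ n"

definition beta :: "mpqrs \<Rightarrow> nat \<Rightarrow> nat \<Rightarrow> real" where
  "beta W i0 n =
     (xi W 1 ^ n - u_ratio W * xi W 2 ^ n) / (xi W 1 ^ i0 - u_ratio W * xi W 2 ^ i0)"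

definition gam :: "mpqrs \<Rightarrow> nat \<Rightarrow> nat \<Rightarrow> real" where
  "gam W i0 i =
     xi W i powi (- int i0) * (rr W S1 - 1 + qr W S1 * (beta W i0 (i0 + 1) + xi W i))"

definition mu :: "mpqrs \<Rightarrow> nat \<Rightarrow> real" where
  "mu W i =
     xi W i powi (- int (posM W)) *
     (1 - rr W SM - pr W SM * xi W i powi (- 1)
        - (pr W S2 * qr W SM * phi W (posM W - 1)) / (qr W S2 * phi W (posM W)))"

text \<open>The common denominator \<open>\<gamma>\<^sub>1 \<mu>\<^sub>2 - \<gamma>\<^sub>2 \<mu>\<^sub>1\<close>.\<close>
definition gm_det :: "mpqrs \<Rightarrow> nat \<Rightarrow> real" where
  "gm_det W i0 = gam W i0 1 * mu W 2 - gam W i0 2 * mu W 1"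

end

theory Submission
  imports Defs
begin

text \<open>
  Write \<open>x\<close> for the vector of expected visits. Conditioning on the last step gives the balance
  equations \<open>x = e \<delta>\<^bsub>i\<^sub>0\<^esub> + x P\<close> with \<open>e = 1\<close>, where \<open>P\<close> is the substochastic transition matrix.
  Inside each of the two regions they are a three-term recurrence with constant coefficients, whose
  characteristic roots are \<open>\<eta>\<^sub>1, \<eta>\<^sub>2\<close> below \<open>M\<close> and \<open>\<xi>\<^sub>1, \<xi>\<^sub>2\<close> above it. The states \<open>0\<close>, \<open>M\<close>, \<open>N\<close> have their
  own probabilities, but multiplying \<open>x\<close> by a constant there makes the recurrences valid right
  up to the ends of the regions. The equation at \<open>0\<close> then forces \<open>x\<close> to be proportional to \<open>\<phi>\<close>
  below \<open>M\<close>, the one at \<open>N\<close> forces it to be proportional to \<open>\<beta>\<close> from \<open>i\<^sub>0\<close> on (both by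
  \<open>proportional_solutions\<close>), the one at \<open>M\<close> fixes the combination of \<open>\<xi>\<^sub>1\<^sup>n\<close> and \<open>\<xi>\<^sub>2\<^sup>n\<close> between \<open>M\<close>
  and \<open>i\<^sub>0\<close> up to the factor \<open>x\<^sub>M\<close>, and the one at \<open>i\<^sub>0\<close> determines \<open>x\<^sub>M\<close> (\<open>flow_at_M\<close>).

  The series defining \<open>x\<close> might diverge: nothing in the hypotheses says that the particle is
  eventually absorbed. Convergence is hidden in the nonvanishing of the denominators. Solving the
  balance equations for an arbitrary source \<open>e\<close> shows, for \<open>e = 0\<close>, that \<open>P\<close> has no nonzero
  invariant vector (\<open>no_source_no_flow\<close>). On the other hand, if some state had infinitely many
  expected visits, then the normalised expected numbers of visits during the first \<open>K\<close> steps
  would accumulate, as \<open>K\<close> grows, at a probability vector invariant under \<open>P\<close>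
  (\<open>summable_of_no_invariant_vector\<close>). Thus a single computation yields both the convergence
  (\<open>e = 0\<close>) and the values (\<open>e = 1\<close>).
\<close>

section \<open>Transient finite chains\<close>

lemma finite_family_convergent_subsequence:
  fixes f :: "nat \<Rightarrow> 'a \<Rightarrow> real"
  assumes "finite A" "\<And>n. n \<in> A \<Longrightarrow> bounded (range (\<lambda>k. f k n))"
  shows "\<exists>h l. strict_mono h \<and> (\<forall>n\<in>A. (\<lambda>k. f (h k) n) \<longlonglongrightarrow> l n)"
  using assms
proof (induction A rule: finite_induct)
  case empty
  show ?case using strict_mono_id by auto
next
  case (insert a A)
  then obtain h l where h: "strict_mono h" "\<forall>n\<in>A. (\<lambda>k. f (h k) n) \<longlonglongrightarrow> l n"
    by auto
  have "bounded (range (\<lambda>k. f k a))" by (rule insert.prems) simp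
  then have "bounded (range (\<lambda>k. f (h k) a))"
    by (rule bounded_subset) auto
  then obtain c g where g: "strict_mono g" "((\<lambda>k. f (h k) a) \<circ> g) \<longlonglongrightarrow> c"
    using bounded_imp_convergent_subsequence by blast
  have "(\<lambda>k. f ((h \<circ> g) k) n) \<longlonglongrightarrow> (l(a := c)) n" if "n \<in> insert a A" for n
  proof (cases "n = a")
    case True
    then show ?thesis using g(2) by (simp add: o_def)
  next
    case False
    then have "(\<lambda>k. f (h k) n) \<longlonglongrightarrow> l n" using that h(2) by auto
    then have "((\<lambda>k. f (h k) n) \<circ> g) \<longlonglongrightarrow> l n" using g(1) by (rule LIMSEQ_subseq_LIMSEQ)
    then show ?thesis using False by (simp add: o_def)
  qed
  then show ?case using strict_mono_o[OF h(1) g(1)] by blast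
qed

text \<open>
  The Krylov--Bogolyubov averaging argument: the partial sums \<open>G K\<close> of the distributions satisfy the
  balance equations up to terms bounded by \<open>1\<close>. If their total mass \<open>S K\<close> is unbounded, those
  terms disappear after division by it, and any limit point of \<open>G K / S K\<close> is invariant
  with total mass \<open>1\<close>.
\<close>

lemma summable_of_no_invariant_vector:
  fixes v :: "nat \<Rightarrow> 'a \<Rightarrow> real" and P :: "'a \<Rightarrow> 'a \<Rightarrow> real"
  assumes fin: "finite A"
    and nonneg: "\<And>k n. 0 \<le> v k n" and le1: "\<And>k n. v k n \<le> 1"
    and step: "\<And>k n. n \<in> A \<Longrightarrow> v (Suc k) n = (\<Sum>m\<in>A. v k m * P m n)"
    and no_inv: "\<And>\<pi> n. (\<And>n. n \<in> A \<Longrightarrow> \<pi> n = (\<Sum>m\<in>A. \<pi> m * P m n)) \<Longrightarrow> n \<in> A \<Longrightarrow> \<pi> n = 0"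
    and "n \<in> A"
  shows "summable (\<lambda>k. v k n)"
proof (rule ccontr)
  assume nsum: "\<not> summable (\<lambda>k. v k n)"
  define G where "G = (\<lambda>K m. \<Sum>k<K. v k m)"
  define S where "S = (\<lambda>K. \<Sum>m\<in>A. G K m)"
  have G0: "0 \<le> G K m" for K m
    unfolding G_def by (intro sum_nonneg nonneg)
  have G_le: "G K m \<le> S K" if "m \<in> A" for K m
    unfolding S_def using that fin G0 by (intro member_le_sum) auto
  have G_mono: "G K m \<le> G L m" if "K \<le> L" for K L m
    unfolding G_def using that nonneg by (intro sum_mono2) auto
  have S_mono: "S K \<le> S L" if "K \<le> L" for K L
    unfolding S_def using that by (intro sum_mono G_mono)
  have S_top: "filterlim S at_top sequentially"
    unfolding filterlim_at_top
  proof
    fix Z :: real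
    have "\<exists>K. Z < S K"
    proof (rule ccontr)
      assume "\<not> ?thesis"
      then have "\<And>K. G K n \<le> Z" using G_le[OF \<open>n \<in> A\<close>] by (meson not_less order_trans)
      then have "summable (\<lambda>k. v k n)"
        unfolding G_def using nonneg
        by (intro bounded_imp_summable[where B = Z]) (simp_all only: lessThan_Suc_atMost[symmetric])
      then show False using nsum by simp
    qed
    then obtain K where "Z < S K" by blast
    then show "\<forall>\<^sub>F L in sequentially. Z \<le> S L"
      unfolding eventually_sequentially using S_mono[of K] less_imp_le order_trans by blast
  qed
  have quot01: "0 \<le> G K m / S K \<and> G K m / S K \<le> 1" if "m \<in> A" for K m
    using G0[of K m] G_le[OF that, of K] by (auto simp: divide_le_eq_1)
  have "bounded (range (\<lambda>K. G K m / S K))" if "m \<in> A" for m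
    using quot01[OF that] by (intro bounded_subset[OF bounded_closed_interval[of 0 1]]) auto
  from finite_family_convergent_subsequence[of A "\<lambda>K m. G K m / S K", OF fin this]
  obtain h \<pi> where h: "strict_mono h"
    and lim: "\<And>m. m \<in> A \<Longrightarrow> (\<lambda>k. G (h k) m / S (h k)) \<longlonglongrightarrow> \<pi> m" by blast
  have Sh: "filterlim (\<lambda>k. S (h k)) at_top sequentially"
    using filterlim_compose[OF S_top filterlim_subseq[OF h]] .
  have bounded_over_S: "(\<lambda>k. c k / S (h k)) \<longlonglongrightarrow> 0" if "\<And>k. 0 \<le> c k" "\<And>k. c k \<le> 1" for c :: "nat \<Rightarrow> real"
  proof (rule tendsto_sandwich[where f = "\<lambda>_. 0" and h = "\<lambda>k. 1 / S (h k)"])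
    show "(\<lambda>k. 1 / S (h k)) \<longlonglongrightarrow> 0"
      using tendsto_divide_0[OF tendsto_const filterlim_at_top_imp_at_infinity[OF Sh]] .
    have pos: "\<forall>\<^sub>F k in sequentially. 0 < S (h k)"
      using Sh by (simp add: filterlim_at_top_dense)
    show "\<forall>\<^sub>F k in sequentially. 0 \<le> c k / S (h k)"
      using pos by eventually_elim (use that in auto)
    show "\<forall>\<^sub>F k in sequentially. c k / S (h k) \<le> 1 / S (h k)"
      using pos by eventually_elim (use that in \<open>auto intro: divide_right_mono\<close>)
  qed auto
  have G_step: "G K m + v K m = v 0 m + (\<Sum>j\<in>A. G K j * P j m)" if "m \<in> A" for K m
  proof -
    have "G K m + v K m = (\<Sum>k<Suc K. v k m)" by (simp add: G_def)
    also have "\<dots> = v 0 m + (\<Sum>k<K. v (Suc k) m)" by (rule sum.lessThan_Suc_shift)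
    also have "(\<Sum>k<K. v (Suc k) m) = (\<Sum>k<K. \<Sum>j\<in>A. v k j * P j m)"
      using step[OF that] by simp
    also have "\<dots> = (\<Sum>j\<in>A. \<Sum>k<K. v k j * P j m)" by (rule sum.swap)
    also have "\<dots> = (\<Sum>j\<in>A. G K j * P j m)" by (simp add: G_def sum_distrib_right)
    finally show ?thesis .
  qed
  have invariant: "\<pi> m = (\<Sum>j\<in>A. \<pi> j * P j m)" if m: "m \<in> A" for m
  proof -
    have "(\<lambda>k. G (h k) m / S (h k) + v (h k) m / S (h k)) \<longlonglongrightarrow> \<pi> m + 0"
      by (intro tendsto_add lim m bounded_over_S nonneg le1)
    moreover have "(\<lambda>k. v 0 m / S (h k) + (\<Sum>j\<in>A. G (h k) j / S (h k) * P j m))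
        \<longlonglongrightarrow> 0 + (\<Sum>j\<in>A. \<pi> j * P j m)"
      by (intro tendsto_add bounded_over_S nonneg le1 tendsto_sum tendsto_mult tendsto_const lim)
    moreover have "G K m / S K + v K m / S K = v 0 m / S K + (\<Sum>j\<in>A. G K j / S K * P j m)" for K
      using arg_cong[OF G_step[OF m, of K], of "\<lambda>x. x / S K"]
      by (simp add: add_divide_distrib sum_divide_distrib)
    ultimately have "\<pi> m + 0 = 0 + (\<Sum>j\<in>A. \<pi> j * P j m)"
      by (simp only:) (rule LIMSEQ_unique)
    then show ?thesis by simp
  qed
  have "(\<lambda>k. \<Sum>m\<in>A. G (h k) m / S (h k)) \<longlonglongrightarrow> (\<Sum>m\<in>A. \<pi> m)"
    by (intro tendsto_sum lim)
  moreover have "\<forall>\<^sub>F k in sequentially. (\<Sum>m\<in>A. G (h k) m / S (h k)) = 1"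
  proof -
    have "\<forall>\<^sub>F k in sequentially. 0 < S (h k)"
      using Sh by (simp add: filterlim_at_top_dense)
    then show ?thesis
      by eventually_elim (simp add: S_def flip: sum_divide_distrib)
  qed
  ultimately have "(\<Sum>m\<in>A. \<pi> m) = 1"
    using LIMSEQ_unique[OF _ tendsto_eventually] by blast
  moreover have "(\<Sum>m\<in>A. \<pi> m) = 0"
    using no_inv[of \<pi>, OF invariant] by (intro sum.neutral) blast
  ultimately show False by simp
qed

text \<open>
  The limiting form of the balance equations, available once the series are known to converge.
\<close>

lemma suminf_invariance:
  fixes v :: "nat \<Rightarrow> 'a \<Rightarrow> real" and P :: "'a \<Rightarrow> 'a \<Rightarrow> real"
  assumes step: "\<And>k n. n \<in> A \<Longrightarrow> v (Suc k) n = (\<Sum>m\<in>A. v k m * P m n)"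
    and summable: "\<And>n. n \<in> A \<Longrightarrow> summable (\<lambda>k. v k n)" and n: "n \<in> A"
  shows "(\<Sum>k. v k n) = v 0 n + (\<Sum>m\<in>A. (\<Sum>k. v k m) * P m n)"
proof -
  have "(\<Sum>k. v (Suc k) n) = (\<Sum>k. \<Sum>m\<in>A. v k m * P m n)"
    using step[OF n] by simp
  also have "\<dots> = (\<Sum>m\<in>A. \<Sum>k. v k m * P m n)"
    by (intro suminf_sum summable_mult2 summable)
  also have "\<dots> = (\<Sum>m\<in>A. (\<Sum>k. v k m) * P m n)"
    by (intro sum.cong refl suminf_mult2[symmetric] summable)
  finally show ?thesis
    using suminf_split_head[OF summable[OF n]] by simp
qed

section \<open>Three-term recurrences\<close>

lemma recurrence_determined:
  fixes f g :: "nat \<Rightarrow> real"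
  assumes a: "a \<noteq> 0"
    and f: "\<And>n. m < n \<Longrightarrow> n < k \<Longrightarrow> a * f (n + 1) = b * f n - c * f (n - 1)"
    and g: "\<And>n. m < n \<Longrightarrow> n < k \<Longrightarrow> a * g (n + 1) = b * g n - c * g (n - 1)"
    and init: "f m = g m" "f (m + 1) = g (m + 1)"
    and n: "m \<le> n" "n \<le> k"
  shows "f n = g n"
  using n
proof (induction n rule: less_induct)
  case (less n)
  consider "n = m" | "n = m + 1" | "m + 1 < n" using less.prems by linarith
  then show ?case
  proof cases
    case 3
    define j where "j = n - 1"
    have j: "n = j + 1" "m < j" using 3 by (auto simp: j_def)
    have "f j = g j" "f (j - 1) = g (j - 1)" using less j by auto
    then have "a * f n = a * g n" using f[of j] g[of j] j less.prems by simp
    then show ?thesis using a by simp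
  qed (use init in auto)
qed

text \<open>
  The Casoratian \<open>f n * g (n + 1) - f (n + 1) * g n\<close> is multiplied by \<open>c / a\<close> at each step, so if it
  vanishes anywhere it vanishes at the left end. There the initial data of \<open>f\<close> and \<open>g\<close> are
  linearly dependent, and the dependence propagates. The anchor \<open>j\<close> is arbitrary because a
  region may get its boundary condition from its left or from its right end.
\<close>

lemma proportional_solutions:
  fixes f g :: "nat \<Rightarrow> real"
  assumes a: "a \<noteq> 0" and c: "c \<noteq> 0"
    and f: "\<And>n. m < n \<Longrightarrow> n < k \<Longrightarrow> a * f (n + 1) = b * f n - c * f (n - 1)"
    and g: "\<And>n. m < n \<Longrightarrow> n < k \<Longrightarrow> a * g (n + 1) = b * g n - c * g (n - 1)"
    and j: "m \<le> j" "j < k" and casoratian: "f j * g (j + 1) = f (j + 1) * g j"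
    and i: "m \<le> i" "i \<le> k" and n: "m \<le> n" "n \<le> k"
  shows "f i * g n = f n * g i"
proof -
  define C where "C n = f n * g (n + 1) - f (n + 1) * g n" for n
  have C_step: "a * C n = c * C (n - 1)" if "m < n" "n < k" for n
  proof -
    have "a * C n = f n * (a * g (n + 1)) - (a * f (n + 1)) * g n"
      by (simp add: C_def algebra_simps)
    also have "\<dots> = c * C (n - 1)"
      unfolding f[OF that] g[OF that] using that by (simp add: C_def algebra_simps)
    finally show ?thesis .
  qed
  have "C m = 0" using j casoratian
  proof (induction j)
    case 0
    then show ?case by (simp add: C_def)
  next
    case (Suc j)
    show ?case
    proof (cases "m = Suc j")
      case False
      then have "c * C j = 0" using C_step[of "Suc j"] Suc.prems by (simp add: C_def)
      then show ?thesis using Suc c False by (simp add: C_def)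
    qed (use Suc.prems in \<open>simp add: C_def\<close>)
  qed
  then have Cm: "f m * g (m + 1) = f (m + 1) * g m" by (simp add: C_def)
  have "\<exists>s s'. (s \<noteq> 0 \<or> s' \<noteq> 0) \<and> s * f m = s' * g m \<and> s * f (m + 1) = s' * g (m + 1)"
  proof (cases "f m = 0 \<and> f (m + 1) = 0")
    case True
    then show ?thesis by (intro exI[of _ 1] exI[of _ 0]) simp
  next
    case False
    then show ?thesis
    proof (cases "f m = 0")
      case True
      then show ?thesis using False Cm
        by (intro exI[of _ "g (m + 1)"] exI[of _ "f (m + 1)"]) (auto simp: algebra_simps)
    next
      case f: False
      then show ?thesis using Cm
        by (intro exI[of _ "g m"] exI[of _ "f m"]) (auto simp: algebra_simps)
    qed
  qed
  then obtain s s' where s: "s \<noteq> 0 \<or> s' \<noteq> 0"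
    and init: "s * f m = s' * g m" "s * f (m + 1) = s' * g (m + 1)" by blast
  have scaled: "a * (z * h (n + 1)) = b * (z * h n) - c * (z * h (n - 1))"
    if "a * h (n + 1) = b * h n - c * h (n - 1)" for h :: "nat \<Rightarrow> real" and z n
    using arg_cong[OF that, of "\<lambda>y. z * y"] by (simp add: algebra_simps)
  have same: "s * f n = s' * g n" if "m \<le> n" "n \<le> k" for n
    by (rule recurrence_determined[OF a scaled[OF f] scaled[OF g] init that])
  have "(s * f i) * g n = (s * f n) * g i" 
    unfolding same[OF i] same[OF n] by simp
  moreover have "f i * (s' * g n) = f n * (s' * g i)"
    unfolding same[OF i, symmetric] same[OF n, symmetric] by simp
  ultimately show ?thesis using s by (auto simp: mult_ac)
qed

lemma power_solves_recurrence:
  fixes \<rho> :: real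
  assumes "a * \<rho>\<^sup>2 = b * \<rho> - c" "0 < n"
  shows "a * \<rho> ^ (n + 1) = b * \<rho> ^ n - c * \<rho> ^ (n - 1)"
proof -
  obtain j where "n = Suc j" using assms(2) by (cases n) auto
  moreover have "a * \<rho> ^ (j + 2) = (b * \<rho> - c) * \<rho> ^ j"
    by (simp add: assms(1)[symmetric] power_add power2_eq_square)
  ultimately show ?thesis by (simp add: algebra_simps)
qed

lemma power_comb_solves_recurrence:
  fixes \<rho> \<sigma> :: real
  assumes "a * \<rho>\<^sup>2 = b * \<rho> - c" "a * \<sigma>\<^sup>2 = b * \<sigma> - c" "0 < n"
  shows "a * (A * \<rho> ^ (n + 1) - B * \<sigma> ^ (n + 1))
    = b * (A * \<rho> ^ n - B * \<sigma> ^ n) - c * (A * \<rho> ^ (n - 1) - B * \<sigma> ^ (n - 1))"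
proof -
  have "a * (A * \<rho> ^ (n + 1) - B * \<sigma> ^ (n + 1)) = A * (a * \<rho> ^ (n + 1)) - B * (a * \<sigma> ^ (n + 1))"
    by (simp add: algebra_simps)
  then show ?thesis
    unfolding power_solves_recurrence[OF assms(1,3)] power_solves_recurrence[OF assms(2,3)]
    by (simp add: algebra_simps)
qed

section \<open>Balance equations of the walk\<close>

lemma walk_step_pmf_wf:
  assumes "is_mpqrs W" "a = site_of W n"
  shows "pmf_of_list_wf [(Some (n + 1), pr W a), (Some (n - 1), qr W a), (Some n, rr W a), (None, sr W a)]"
proof -
  have "pr W a + qr W a + rr W a + sr W a = 1" using assms(1) by (simp add: is_mpqrs_def)
  then show ?thesis using assms(1) by (auto simp: is_mpqrs_def pmf_of_list_wf_def add.assoc)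
qed

lemma pmf_walk_step_Some:
  assumes "is_mpqrs W"
  shows "pmf (walk_step W m) (Some n) =
    (if m = n then rr W (site_of W n) else 0) + (if m + 1 = n then pr W (site_of W m) else 0)
      + (if m = n + 1 then qr W (site_of W m) else 0)"
proof -
  \<comment> \<open>The truncated step from \<open>0\<close> down to \<open>0 - 1 = 0\<close> has weight \<open>0\<close>.\<close>
  have "qr W (site_of W 0) = 0" using assms by (simp add: is_mpqrs_def site_of_def)
  then show ?thesis
    unfolding walk_step_def Let_def pmf_pmf_of_list[OF walk_step_pmf_wf[OF assms refl]]
    by (cases m) auto
qed

lemma sum_walk_step:
  fixes x :: "nat \<Rightarrow> real"
  assumes W: "is_mpqrs W" and n: "n \<le> posN W"
  shows "(\<Sum>m\<le>posN W. x m * pmf (walk_step W m) (Some n)) =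
    rr W (site_of W n) * x n + (if n = 0 then 0 else pr W (site_of W (n - 1)) * x (n - 1))
      + (if n = posN W then 0 else qr W (site_of W (n + 1)) * x (n + 1))"
proof -
  have "(\<Sum>m\<le>posN W. x m * pmf (walk_step W m) (Some n)) =
      (\<Sum>m\<le>posN W. if m = n then rr W (site_of W n) * x n else 0)
    + (\<Sum>m\<le>posN W. if m = n - 1 then (if n = 0 then 0 else pr W (site_of W (n - 1)) * x (n - 1)) else 0)
    + (\<Sum>m\<le>posN W. if m = n + 1 then qr W (site_of W (n + 1)) * x (n + 1) else 0)"
    unfolding pmf_walk_step_Some[OF W] sum.distrib[symmetric]
    by (intro sum.cong) auto
  also have "\<dots> = rr W (site_of W n) * x n
      + (if n = 0 then 0 else pr W (site_of W (n - 1)) * x (n - 1))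
      + (if n = posN W then 0 else qr W (site_of W (n + 1)) * x (n + 1))"
    using n by (auto simp: sum.delta)
  finally show ?thesis .
qed

lemma set_walk_subset:
  assumes W: "is_mpqrs W" and i: "i \<le> posN W"
  shows "set_pmf (walk W i k) \<subseteq> insert None (Some ` {..posN W})"
proof (induction k)
  case 0
  then show ?case using i by auto
next
  case (Suc k)
  have "set_pmf (walk_step W m) \<subseteq> insert None (Some ` {..posN W})" if m: "m \<le> posN W" for m
  proof -
    have up: "pr W (site_of W (posN W)) = 0"
      using W by (auto simp: is_mpqrs_def site_of_def)
    have "y \<le> posN W" if "Some y \<in> set_pmf (walk_step W m)" for y
      using that m up unfolding set_pmf_iff pmf_walk_step_Some[OF W]
      by (auto split: if_splits simp: le_less)
    then show ?thesis by (metis atMost_iff image_eqI insertCI not_None_eq subsetI)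
  qed
  note walk_step = this
  have step: "set_pmf (case y of None \<Rightarrow> return_pmf None | Some m \<Rightarrow> walk_step W m)
      \<subseteq> insert None (Some ` {..posN W})" if "y \<in> set_pmf (walk W i k)" for y
  proof (cases y)
    case (Some m)
    then have "m \<le> posN W" using that Suc.IH by auto
    then show ?thesis using walk_step Some by simp
  qed simp
  have "set_pmf (walk W i (Suc k)) = (\<Union>y\<in>set_pmf (walk W i k).
      set_pmf (case y of None \<Rightarrow> return_pmf None | Some m \<Rightarrow> walk_step W m))"
    by (simp add: set_bind_pmf)
  then show ?case using UN_least[OF step] by (simp only:)
qed

lemma kprob_Suc:
  assumes W: "is_mpqrs W" and i: "i \<le> posN W"
  shows "kprob W (Suc k) i n = (\<Sum>m\<le>posN W. kprob W k i m * pmf (walk_step W m) (Some n))"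
proof -
  let ?f = "\<lambda>x. pmf (case x of None \<Rightarrow> return_pmf None | Some n \<Rightarrow> walk_step W n) (Some n)"
  have "kprob W (Suc k) i n = measure_pmf.expectation (walk W i k) ?f"
    by (simp add: kprob_def pmf_bind)
  also have "\<dots> = (\<Sum>x\<in>insert None (Some ` {..posN W}). ?f x * pmf (walk W i k) x)"
    using set_walk_subset[OF W i, of k] by (intro integral_measure_pmf_real) auto
  also have "\<dots> = (\<Sum>x\<in>Some ` {..posN W}. ?f x * pmf (walk W i k) x)"
    by (subst sum.insert) auto
  also have "\<dots> = (\<Sum>m\<le>posN W. kprob W k i m * pmf (walk_step W m) (Some n))"
    by (simp add: sum.reindex kprob_def mult.commute)
  finally show ?thesis .
qed


section \<open>Solving the balance equations\<close>

text \<open>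
  The source strength \<open>e\<close> is a parameter: \<open>e = 1\<close> describes the expected visits of a walk started
  in \<open>i\<close>, and \<open>e = 0\<close> describes invariant vectors.
\<close>

definition balanced :: "mpqrs \<Rightarrow> nat \<Rightarrow> real \<Rightarrow> (nat \<Rightarrow> real) \<Rightarrow> bool" where
  "balanced W i e x \<longleftrightarrow> (\<forall>n\<le>posN W.
     x n = (if n = i then e else 0) + (\<Sum>m\<le>posN W. x m * pmf (walk_step W m) (Some n)))"

text \<open>
  Vieta's formulas. The roots are real because \<open>1 - r \<ge> p + q \<ge> 2 sqrt (p q)\<close>.
\<close>

lemma quadratic_roots:
  fixes p q r :: real
  assumes "0 < p" "0 < q" "p + q + r \<le> 1"
  defines "d \<equiv> sqrt ((1 - r)\<^sup>2 - 4 * p * q)"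
  defines "a \<equiv> ((1 - r) + d) / (2 * q)" and "b \<equiv> ((1 - r) - d) / (2 * q)"
  shows "q * (a + b) = 1 - r" "q * (a * b) = p" "q * (a - b) = d"
    "q * a\<^sup>2 = (1 - r) * a - p" "q * b\<^sup>2 = (1 - r) * b - p"
proof -
  have "(p + q)\<^sup>2 \<le> (1 - r)\<^sup>2" using assms by (intro power_mono) auto
  moreover have "4 * p * q \<le> (p + q)\<^sup>2"
    using zero_le_power2[of "p - q"] by (simp add: power2_eq_square algebra_simps)
  ultimately have d2: "d\<^sup>2 = (1 - r)\<^sup>2 - 4 * p * q" unfolding d_def by simp
  have a: "q * a = ((1 - r) + d) / 2" and b: "q * b = ((1 - r) - d) / 2"
    using assms by (simp_all add: a_def b_def)
  show sum: "q * (a + b) = 1 - r" and "q * (a - b) = d"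
    using a b by (simp_all add: algebra_simps) 
  have "q * (q * (a * b)) = (q * a) * (q * b)" by (simp add: algebra_simps)
  also have "\<dots> = q * p" unfolding a b using d2 by (simp add: power2_eq_square algebra_simps)
  finally show prod: "q * (a * b) = p" using assms by simp
  have "q * a\<^sup>2 = (q * (a + b)) * a - q * (a * b)" "q * b\<^sup>2 = (q * (a + b)) * b - q * (a * b)"
    by (simp_all add: power2_eq_square algebra_simps)
  then show "q * a\<^sup>2 = (1 - r) * a - p" "q * b\<^sup>2 = (1 - r) * b - p"
    unfolding sum prod by simp_all
qed

locale balanced_flow =
  fixes W :: mpqrs and i0 :: nat and e :: real and x :: "nat \<Rightarrow> real"
  assumes walk: "is_mpqrs W"
    and start: "posM W < i0" "i0 < posN W"
    and t2: "tt W 2 \<noteq> 0"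
    and u2: "uu W 2 \<noteq> 0"
    and phiM: "phi W (posM W) \<noteq> 0"
    and beta_den: "xi W 1 ^ i0 - u_ratio W * xi W 2 ^ i0 \<noteq> 0"
    and balanced: "balanced W i0 e x"
begin

abbreviation "M \<equiv> posM W"
abbreviation "N \<equiv> posN W"

lemma pos: "0 < pr W S1" "0 < qr W S1" "0 < pr W S2" "0 < qr W S2" "0 < M" "M < N"
  using walk by (auto simp: is_mpqrs_def)

lemma step_prob_le1: "pr W a + qr W a + rr W a \<le> 1"
proof -
  have "pr W a + qr W a + rr W a + sr W a = 1" "0 \<le> sr W a" using walk by (auto simp: is_mpqrs_def)
  then show ?thesis by linarith
qed

lemma xi_eqs:
  "qr W S1 * (xi W 1 + xi W 2) = 1 - rr W S1"
  "qr W S1 * (xi W 1 * xi W 2) = pr W S1"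
  "qr W S1 * (xi W 1 - xi W 2) = lam W S1"
  "qr W S1 * (xi W 1)\<^sup>2 = (1 - rr W S1) * xi W 1 - pr W S1"
  "qr W S1 * (xi W 2)\<^sup>2 = (1 - rr W S1) * xi W 2 - pr W S1"
  using quadratic_roots[OF pos(1,2) step_prob_le1]
  by (simp_all add: xi_def lam_def)

lemma xi_nz: "xi W 1 \<noteq> 0" "xi W 2 \<noteq> 0"
  using xi_eqs(2) pos by auto

lemma eta_eqs:
  "qr W S2 * (eta W 1)\<^sup>2 = (1 - rr W S2) * eta W 1 - pr W S2"
  "qr W S2 * (eta W 2)\<^sup>2 = (1 - rr W S2) * eta W 2 - pr W S2"
  using quadratic_roots[OF pos(3,4) step_prob_le1]
  by (simp_all add: eta_def lam_def)

text \<open>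
  If the roots coincided, then \<open>u = 1\<close> and the denominator of \<open>\<beta>\<close> would vanish.
\<close>

lemma lam_nz: "lam W S1 \<noteq> 0"
proof
  assume "lam W S1 = 0"
  then have xi: "xi W 1 = xi W 2" using xi_eqs(3) pos by simp
  then have "u_ratio W = 1" using u2 by (simp add: u_ratio_def uu_def)
  then show False using beta_den xi by simp
qed

lemma balance_at:
  assumes "n \<le> N"
  shows "(1 - rr W (site_of W n)) * x n = (if n = i0 then e else 0)
      + (if n = 0 then 0 else pr W (site_of W (n - 1)) * x (n - 1))
      + (if n = N then 0 else qr W (site_of W (n + 1)) * x (n + 1))"
proof -
  have "x n = (if n = i0 then e else 0) + (\<Sum>m\<le>N. x m * pmf (walk_step W m) (Some n))"
    using balanced assms by (simp add: balanced_def)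
  then show ?thesis
    unfolding sum_walk_step[OF walk assms] by (simp add: left_diff_distrib)
qed

text \<open>
  The flow on \<open>{0..M}\<close>, rescaled at the two ends: \<open>p\<^sub>2 low n\<close> is the upward flux out of each \<open>n < M\<close>
  and \<open>q\<^sub>2 low n\<close> the downward flux out of each \<open>n\<close> with \<open>0 < n \<le> M\<close>, so that the ends look like
  states of the region. This also covers \<open>M = 1\<close>, where the region is empty.
\<close>

definition low :: "nat \<Rightarrow> real" where
  "low n = (if n = 0 then pr W S0 / pr W S2 * x 0
          else if n < M then x n else qr W SM / qr W S2 * x M)"

lemma low_up: "n < M \<Longrightarrow> pr W (site_of W n) * x n = pr W S2 * low n"
  and low_down: "0 < n \<Longrightarrow> n \<le> M \<Longrightarrow> qr W (site_of W n) * x n = qr W S2 * low n"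
  using pos by (auto simp: low_def site_of_def)

lemma low_recurrence:
  assumes "0 < n" "n < M"
  shows "qr W S2 * low (n + 1) = (1 - rr W S2) * low n - pr W S2 * low (n - 1)"
proof -
  have "site_of W n = S2" "low n = x n" using assms by (simp_all add: site_of_def low_def)
  then show ?thesis
    using balance_at[of n] low_up[of "n - 1"] low_down[of "n + 1"] assms start pos by simp
qed

text \<open>
  A trap at \<open>0\<close> would have \<open>p\<^sub>0 = 0\<close> as well, hence \<open>t\<^sub>1 = t\<^sub>2 = 0\<close>; likewise a trap at \<open>N\<close> would give
  \<open>u\<^sub>1 = u\<^sub>2 = 0\<close>.
\<close>

lemma stay0: "1 - rr W S0 \<noteq> 0"
proof
  assume r0: "1 - rr W S0 = 0"
  have "pr W S0 = 0"
    using step_prob_le1[of S0] r0 walk by (simp add: is_mpqrs_def order_antisym)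
  then show False using r0 t2 by (simp add: tt_def)
qed

lemma stayN: "1 - rr W SN \<noteq> 0"
proof
  assume rN: "1 - rr W SN = 0"
  have "qr W SN = 0"
    using step_prob_le1[of SN] rN walk by (simp add: is_mpqrs_def order_antisym)
  then show False using rN u2 by (simp add: uu_def)
qed

lemma balance_0: "(1 - rr W S0) * x 0 = qr W S2 * low 1"
  using balance_at[of 0] low_down[of 1] start pos by (simp add: site_of_def)

text \<open>
  The coefficient \<open>t\<close> in \<open>\<phi>\<close> is chosen to make \<open>\<phi>\<close> satisfy the balance equation at \<open>0\<close> in its
  rescaled form.
\<close>

lemma phi_boundary: "pr W S2 * (1 - rr W S0) * phi W 0 = pr W S0 * qr W S2 * phi W 1"
proof -
  have "tt W 2 * phi W 0 = tt W 2 - tt W 1" "tt W 2 * phi W 1 = eta W 1 * tt W 2 - eta W 2 * tt W 1"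
    using t2 by (simp_all add: phi_def t_ratio_def field_simps)
  then have "tt W 2 * (pr W S2 * (1 - rr W S0) * phi W 0) = tt W 2 * (pr W S0 * qr W S2 * phi W 1)"
    unfolding tt_def by algebra
  then show ?thesis using t2 by simp
qed

lemma phi_recurrence:
  "0 < n \<Longrightarrow> qr W S2 * phi W (n + 1) = (1 - rr W S2) * phi W n - pr W S2 * phi W (n - 1)"
  using power_comb_solves_recurrence[OF eta_eqs, of n 1 "t_ratio W"] by (simp add: phi_def)

text \<open>
  \<open>low\<close> and \<open>\<phi>\<close> solve the same recurrence with the same boundary condition at \<open>0\<close>, so their
  Casoratian vanishes there.
\<close>

lemma low_phi:
  assumes "n \<le> M"
  shows "low n = phi W n / phi W M * low M"
proof -
  have "pr W S2 * (1 - rr W S0) * low 0 = pr W S0 * qr W S2 * low 1"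
    using balance_0 pos by (simp add: low_def)
  then have "(pr W S2 * (1 - rr W S0)) * (low 0 * phi W 1) = (pr W S2 * (1 - rr W S0)) * (low 1 * phi W 0)"
    using phi_boundary by algebra
  then have casoratian: "low 0 * phi W (0 + 1) = low (0 + 1) * phi W 0"
    using pos stay0 by simp
  have "low n * phi W M = low M * phi W n"
  proof (rule proportional_solutions[OF _ _ low_recurrence _ _ _ casoratian])
    show "qr W S2 * phi W (n + 1) = (1 - rr W S2) * phi W n - pr W S2 * phi W (n - 1)" if "0 < n" for n
      using phi_recurrence[OF that] .
  qed (use pos assms in auto)
  then show ?thesis using phiM by (simp add: field_simps)
qed

text \<open>
  The same rescaling for \<open>{M..N}\<close>, with \<open>p\<^sub>1\<close> and \<open>q\<^sub>1\<close> in place of \<open>p\<^sub>2\<close> and \<open>q\<^sub>2\<close>.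
\<close>

definition high :: "nat \<Rightarrow> real" where
  "high n = (if n = M then pr W SM / pr W S1 * x M
          else if n = N then qr W SN / qr W S1 * x N else x n)"

lemma high_up: "M \<le> n \<Longrightarrow> n < N \<Longrightarrow> pr W (site_of W n) * x n = pr W S1 * high n"
  and high_down: "M < n \<Longrightarrow> n \<le> N \<Longrightarrow> qr W (site_of W n) * x n = qr W S1 * high n"
  using pos by (auto simp: high_def site_of_def)

lemma balance_interior:
  assumes "M < n" "n < N"
  shows "(1 - rr W S1) * high n = (if n = i0 then e else 0) + pr W S1 * high (n - 1) + qr W S1 * high (n + 1)"
proof -
  have "site_of W n = S1" "high n = x n" using assms by (simp_all add: site_of_def high_def)
  then show ?thesis
    using balance_at[of n] high_up[of "n - 1"] high_down[of "n + 1"] assms by simp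
qed

lemma balance_N: "(1 - rr W SN) * x N = pr W S1 * high (N - 1)"
proof -
  have "site_of W N = SN" using pos by (simp add: site_of_def)
  moreover have "N \<noteq> i0" "N \<noteq> 0" "M \<le> N - 1" "N - 1 < N" using start pos by auto
  ultimately show ?thesis
    using balance_at[of N] high_up[of "N - 1"] by simp
qed

text \<open>
  The coefficient \<open>u\<close> makes the numerator of \<open>\<beta>\<close> satisfy the rescaled balance equation at \<open>N\<close>,
  so here the Casoratian vanishes at the right end.
\<close>

lemma high_beta:
  assumes "i0 \<le> n" "n \<le> N"
  shows "high n = beta W i0 n * high i0"
proof -
  define b where "b n = xi W 1 ^ n - u_ratio W * xi W 2 ^ n" for n
  have b_recurrence: "qr W S1 * b (n + 1) = (1 - rr W S1) * b n - pr W S1 * b (n - 1)" if "0 < n" for n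
    using power_comb_solves_recurrence[OF xi_eqs(4,5) that, of 1 "u_ratio W"] by (simp add: b_def)
  have xi_N: "xi W i ^ N = xi W i ^ (N - 1) * xi W i" for i
    using pos by (metis power_minus_mult gr_implies_not0 not_gr_zero)
  have "uu W 1 - u_ratio W * uu W 2 = 0" using u2 by (simp add: u_ratio_def)
  then have b_boundary: "(qr W S1 * (1 - rr W SN)) * b N = pr W S1 * qr W SN * b (N - 1)"
    by (simp add: uu_def b_def xi_N algebra_simps)
  have high_boundary: "(qr W S1 * (1 - rr W SN)) * high N = pr W S1 * qr W SN * high (N - 1)"
  proof -
    have "qr W S1 * high N = qr W SN * x N" using pos by (simp add: high_def)
    then show ?thesis using balance_N by algebra
  qed
  have "(qr W S1 * (1 - rr W SN)) * (high (N - 1) * b N) = (qr W S1 * (1 - rr W SN)) * (high N * b (N - 1))"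
    using b_boundary high_boundary by algebra
  then have casoratian: "high (N - 1) * b (N - 1 + 1) = high (N - 1 + 1) * b (N - 1)"
    using stayN pos by simp
  have "high n * b i0 = high i0 * b n"
  proof (rule proportional_solutions[OF _ _ _ _ _ _ casoratian])
    show "qr W S1 \<noteq> 0" "pr W S1 \<noteq> 0" using pos by auto
    show "qr W S1 * high (n + 1) = (1 - rr W S1) * high n - pr W S1 * high (n - 1)" if "i0 < n" "n < N" for n
      using balance_interior[of n] that start by simp
    show "qr W S1 * b (n + 1) = (1 - rr W S1) * b n - pr W S1 * b (n - 1)" if "i0 < n" "n < N" for n
      using b_recurrence[of n] that by simp
  qed (use start assms in auto)
  then show ?thesis using beta_den by (simp add: beta_def b_def field_simps)
qed

lemma mu_xi:
  assumes "xi W i \<noteq> 0"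
  shows "mu W i * xi W i ^ M = 1 - rr W SM - pr W SM / xi W i
    - (pr W S2 * qr W SM * phi W (M - 1)) / (qr W S2 * phi W M)"
  using assms by (simp add: mu_def power_int_minus divide_inverse)

lemma gam_xi:
  assumes "xi W i \<noteq> 0"
  shows "gam W i0 i * xi W i ^ i0 = rr W S1 - 1 + qr W S1 * (beta W i0 (i0 + 1) + xi W i)"
  using assms by (simp add: gam_def power_int_minus)

text \<open>
  Both sides solve the recurrence between \<open>M\<close> and \<open>i\<^sub>0\<close>, so it suffices to compare them at \<open>M\<close> and
  \<open>M + 1\<close>. Since \<open>\<mu>\<^sub>i \<xi>\<^sub>i\<^sup>M = A - p\<^sub>M / \<xi>\<^sub>i\<close>, the terms with \<open>A\<close> cancel at \<open>M\<close> and those with \<open>p\<^sub>M\<close> cancel at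
  \<open>M + 1\<close>, where what is left is the balance equation at \<open>M\<close>.
\<close>

lemma high_mu:
  assumes "M \<le> n" "n \<le> i0"
  shows "high n = x M / lam W S1 * (mu W 1 * xi W 1 ^ n - mu W 2 * xi W 2 ^ n)"
proof -
  define D where "D = x M / lam W S1"
  define A where "A = 1 - rr W SM - (pr W S2 * qr W SM * phi W (M - 1)) / (qr W S2 * phi W M)"
  let ?g = "\<lambda>n. D * mu W 1 * xi W 1 ^ n - D * mu W 2 * xi W 2 ^ n"
  have x_M: "x M = D * (qr W S1 * (xi W 1 - xi W 2))"
    using lam_nz xi_eqs(3) by (simp add: D_def)
  have mu: "mu W 1 * xi W 1 ^ M = A - pr W SM / xi W 1" "mu W 2 * xi W 2 ^ M = A - pr W SM / xi W 2"
    using mu_xi xi_nz by (simp_all add: A_def)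
  have "(1 - rr W SM) * x M = pr W S2 * low (M - 1) + qr W S1 * high (M + 1)"
    using balance_at[of M] low_up[of "M - 1"] high_down[of "M + 1"] start pos by (simp add: site_of_def)
  moreover have "low (M - 1) = phi W (M - 1) / phi W M * (qr W SM / qr W S2 * x M)"
    using low_phi[of "M - 1"] pos by (simp add: low_def)
  then have "pr W S2 * low (M - 1) = (pr W S2 * qr W SM * phi W (M - 1)) / (qr W S2 * phi W M) * x M"
    by (simp add: mult_ac)
  ultimately have "qr W S1 * high (M + 1) = A * x M"
    by (simp add: A_def left_diff_distrib)
  then have z1: "high (M + 1) = D * A * (xi W 1 - xi W 2)"
    using pos x_M by simp
  have "?g (M + 1) = D * (xi W 1 * (mu W 1 * xi W 1 ^ M) - xi W 2 * (mu W 2 * xi W 2 ^ M))"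
    by (simp add: algebra_simps)
  also have "\<dots> = high (M + 1)"
    unfolding mu z1 using xi_nz by (simp add: right_diff_distrib)
  finally have init1: "high (M + 1) = ?g (M + 1)" by simp
  have "?g M = D * (mu W 1 * xi W 1 ^ M - mu W 2 * xi W 2 ^ M)"
    by (simp add: algebra_simps)
  also have "\<dots> = D * pr W SM * (1 / xi W 2 - 1 / xi W 1)"
    unfolding mu by (simp add: algebra_simps)
  also have "\<dots> = D * pr W SM * ((xi W 1 - xi W 2) / (xi W 1 * xi W 2))"
    using xi_nz by (simp add: field_simps)
  also have "\<dots> = D * (qr W S1 * (xi W 1 - xi W 2)) * pr W SM / (qr W S1 * (xi W 1 * xi W 2))"
    using pos xi_nz by (simp add: field_simps)
  also have "\<dots> = high M"
    unfolding xi_eqs(2) x_M[symmetric] by (simp add: high_def)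
  finally have init0: "high M = ?g M" by simp
  have "high n = ?g n"
  proof (rule recurrence_determined[where g = ?g and m = M and k = i0])
    show "qr W S1 \<noteq> 0" using pos by simp
    show "qr W S1 * high (n + 1) = (1 - rr W S1) * high n - pr W S1 * high (n - 1)" if "M < n" "n < i0" for n
      using balance_interior[of n] that start by simp
    show "qr W S1 * ?g (n + 1) = (1 - rr W S1) * ?g n - pr W S1 * ?g (n - 1)" if "M < n" "n < i0" for n
      using power_comb_solves_recurrence[OF xi_eqs(4,5)] that by simp
  qed (fact init0 init1 assms)+
  then show ?thesis by (simp add: D_def algebra_simps)
qed

text \<open>
  This is the balance equation at \<open>i\<^sub>0\<close>, the only one that sees the source. By \<open>p\<^sub>1 = q\<^sub>1 \<xi>\<^sub>1 \<xi>\<^sub>2\<close> the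
  coefficients of \<open>\<mu>\<^sub>1 \<xi>\<^sub>1\<^bsup>i\<^sub>0\<^esup>\<close> and \<open>\<mu>\<^sub>2 \<xi>\<^sub>2\<^bsup>i\<^sub>0\<^esup>\<close> in it are proportional to \<open>-\<gamma>\<^sub>2 \<xi>\<^sub>2\<^bsup>i\<^sub>0\<^esup>\<close> and \<open>\<gamma>\<^sub>1 \<xi>\<^sub>1\<^bsup>i\<^sub>0\<^esup>\<close>,
  which produces \<open>\<gamma>\<^sub>1 \<mu>\<^sub>2 - \<gamma>\<^sub>2 \<mu>\<^sub>1\<close>. Keeping the product form, without division by the determinant, makes it
  equally informative for \<open>e = 0\<close>.
\<close>

lemma flow_at_M: "x M * gm_det W i0 = lam W S1 * (qr W S1 / pr W S1) ^ i0 * e"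
proof -
  define D where "D = x M / lam W S1"
  define B where "B = 1 - rr W S1 - qr W S1 * beta W i0 (i0 + 1)"
  obtain j where j: "i0 = Suc j" using start by (cases i0) auto
  have high: "high i0 = D * (mu W 1 * xi W 1 ^ i0 - mu W 2 * xi W 2 ^ i0)"
    "high j = D * (mu W 1 * xi W 1 ^ j - mu W 2 * xi W 2 ^ j)"
    unfolding D_def using high_mu[of i0] high_mu[of j] start j by auto
  have p: "pr W S1 * xi W 1 ^ j = qr W S1 * xi W 2 * xi W 1 ^ i0"
    "pr W S1 * xi W 2 ^ j = qr W S1 * xi W 1 * xi W 2 ^ i0"
    unfolding xi_eqs(2)[symmetric] j by (simp_all add: algebra_simps)
  have B: "B - qr W S1 * xi W 2 = - (gam W i0 2 * xi W 2 ^ i0)"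
    "B - qr W S1 * xi W 1 = - (gam W i0 1 * xi W 1 ^ i0)"
    unfolding B_def gam_xi[OF xi_nz(1)] gam_xi[OF xi_nz(2)] by (simp_all add: algebra_simps)
  have "e = B * high i0 - pr W S1 * high j"
    using balance_interior[of i0] high_beta[of "i0 + 1"] start j by (simp add: B_def algebra_simps)
  also have "pr W S1 * high j = D * (mu W 1 * (pr W S1 * xi W 1 ^ j) - mu W 2 * (pr W S1 * xi W 2 ^ j))"
    unfolding high by (simp add: algebra_simps)
  also have "B * high i0 - \<dots> = D * (mu W 1 * xi W 1 ^ i0 * (B - qr W S1 * xi W 2)
      - mu W 2 * xi W 2 ^ i0 * (B - qr W S1 * xi W 1))"
    unfolding p high by (simp add: algebra_simps)
  also have "\<dots> = D * gm_det W i0 * (xi W 1 * xi W 2) ^ i0"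
    unfolding B by (simp add: gm_det_def power_mult_distrib algebra_simps)
  also have "xi W 1 * xi W 2 = pr W S1 / qr W S1"
    using xi_eqs(2) pos by (simp add: field_simps)
  finally have "e = D * gm_det W i0 * (pr W S1 / qr W S1) ^ i0" .
  then have "(qr W S1 / pr W S1) ^ i0 * e = D * gm_det W i0"
    using pos by (simp add: power_divide)
  then show ?thesis using lam_nz by (simp add: D_def mult.assoc)
qed

text \<open>
  Without a source \<open>x\<close> vanishes at \<open>M\<close>, and from there the solution formulas spread this over both
  regions. The values at \<open>0\<close> and \<open>N\<close> need the balance equations there, because the rescaled values
  carry no information about them when \<open>p\<^sub>0 = 0\<close> or \<open>q\<^sub>N = 0\<close>.
\<close>

lemma no_source_no_flow:
  assumes "e = 0" "gm_det W i0 \<noteq> 0" "n \<le> N"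
  shows "x n = 0"
proof -
  have xM: "x M = 0" using flow_at_M assms by simp
  then have low: "low n = 0" if "n \<le> M" for n
    using low_phi[OF that] pos by (simp add: low_def)
  have high_left: "high n = 0" if "M \<le> n" "n \<le> i0" for n using high_mu[OF that] xM by simp
  then have high: "high n = 0" if "M \<le> n" "n \<le> N" for n
    using that high_beta[of n] start by (cases "n \<le> i0") auto
  have "x 0 = 0" using balance_0 low[of 1] stay0 pos by simp
  moreover have "x N = 0" using balance_N high[of "N - 1"] stayN pos by simp
  moreover have "x n = 0" if "0 < n" "n < M" using low[of n] that by (simp add: low_def)
  moreover have "x n = 0" if "M < n" "n < N" using high[of n] that by (simp add: high_def)
  moreover consider "n = 0" | "0 < n" "n < M" | "n = M" | "M < n" "n < N" | "n = N"
    using assms(3) by linarith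
  ultimately show ?thesis using xM by cases auto
qed

end

section \<open>Expected numbers of visits\<close>

theorem theorem11:
  fixes W :: mpqrs and i0 :: nat
  assumes walk: "is_mpqrs W"
    and start: "posM W < i0" "i0 < posN W"
    and t2: "tt W 2 \<noteq> 0"
    and u2: "uu W 2 \<noteq> 0"
    and phiM: "phi W (posM W) \<noteq> 0"
    and beta_den: "xi W 1 ^ i0 - u_ratio W * xi W 2 ^ i0 \<noteq> 0"
    and det: "gm_det W i0 \<noteq> 0"
  shows
    "(\<forall>n\<le>posN W. summable (\<lambda>k. kprob W k i0 n)) \<and>
     (pr W S0 \<noteq> 0 \<longrightarrow>
        visits W i0 0 =
          (pr W S2 * qr W SM * phi W 0) / (pr W S0 * qr W S2 * phi W (posM W))
            * visits W i0 (posM W)) \<and>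
     (\<forall>n. 1 \<le> n \<and> n \<le> posM W - 1 \<longrightarrow>
        visits W i0 n =
          (qr W SM * phi W n) / (qr W S2 * phi W (posM W)) * visits W i0 (posM W)) \<and>
     visits W i0 (posM W) = lam W S1 * (qr W S1 / pr W S1) ^ i0 / gm_det W i0 \<and>
     (\<forall>n. posM W + 1 \<le> n \<and> n \<le> i0 \<longrightarrow>
        visits W i0 n =
          (qr W S1 / pr W S1) ^ i0 * (mu W 1 * xi W 1 ^ n - mu W 2 * xi W 2 ^ n) / gm_det W i0) \<and>
     (\<forall>n. i0 \<le> n \<and> n \<le> posN W - 1 \<longrightarrow>
        visits W i0 n = beta W i0 n * visits W i0 i0) \<and>
     (qr W SN \<noteq> 0 \<longrightarrow>
        visits W i0 (posN W) = qr W S1 / qr W SN * beta W i0 (posN W) * visits W i0 i0)"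
proof -
  have flow: "balanced_flow W i0 e x" if "balanced W i0 e x" for e x
    using that walk start t2 u2 phiM beta_den by (simp add: balanced_flow_def)
  have step: "kprob W (Suc k) i0 n = (\<Sum>m\<le>posN W. kprob W k i0 m * pmf (walk_step W m) (Some n))" for k n
    using kprob_Suc[OF walk] start by simp
  have summable: "summable (\<lambda>k. kprob W k i0 n)" if "n \<le> posN W" for n
  proof (rule summable_of_no_invariant_vector[where v = "\<lambda>k n. kprob W k i0 n" and A = "{..posN W}"
        and P = "\<lambda>m n. pmf (walk_step W m) (Some n)"])
    fix \<pi> :: "nat \<Rightarrow> real" and n
    assume "\<And>n. n \<in> {..posN W} \<Longrightarrow> \<pi> n = (\<Sum>m\<le>posN W. \<pi> m * pmf (walk_step W m) (Some n))"
      and n: "n \<in> {..posN W}"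
    then have "balanced W i0 0 \<pi>" by (simp add: balanced_def)
    from balanced_flow.no_source_no_flow[OF flow[OF this] refl det] n
    show "\<pi> n = 0" by simp
  qed (use step that in \<open>auto simp: kprob_def pmf_le_1\<close>)
  have "balanced W i0 1 (visits W i0)"
    unfolding balanced_def
  proof (intro allI impI)
    fix n assume n: "n \<le> posN W"
    have "visits W i0 n = kprob W 0 i0 n
        + (\<Sum>m\<le>posN W. visits W i0 m * pmf (walk_step W m) (Some n))"
      unfolding visits_def
      by (rule suminf_invariance[where v = "\<lambda>k n. kprob W k i0 n" and A = "{..posN W}"])
         (use step summable n in auto)
    moreover have "kprob W 0 i0 n = (if n = i0 then 1 else 0)" by (simp add: kprob_def)
    ultimately show "visits W i0 n = (if n = i0 then 1 else 0)
        + (\<Sum>m\<le>posN W. visits W i0 m * pmf (walk_step W m) (Some n))" by simp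
  qed
  then interpret balanced_flow W i0 1 "visits W i0" by (rule flow)
  have xM: "visits W i0 M = lam W S1 * (qr W S1 / pr W S1) ^ i0 / gm_det W i0"
    using flow_at_M det by (simp add: eq_divide_eq)
  have low_M: "low M = qr W SM / qr W S2 * visits W i0 M" using pos by (simp add: low_def)
  have high_i0: "high i0 = visits W i0 i0" using start by (simp add: high_def)
  have "visits W i0 0 =
      (pr W S2 * qr W SM * phi W 0) / (pr W S0 * qr W S2 * phi W M) * visits W i0 M" if "pr W S0 \<noteq> 0"
  proof -
    have "visits W i0 0 = pr W S2 / pr W S0 * low 0" using that pos by (simp add: low_def)
    then show ?thesis using low_phi[of 0] low_M by (simp add: mult_ac)
  qed
  moreover have "visits W i0 n = (qr W SM * phi W n) / (qr W S2 * phi W M) * visits W i0 M"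
    if "1 \<le> n" "n \<le> M - 1" for n
  proof -
    have "visits W i0 n = low n" using that pos by (auto simp: low_def)
    then show ?thesis using low_phi[of n] low_M that by (simp add: mult_ac)
  qed
  moreover have "visits W i0 n =
      (qr W S1 / pr W S1) ^ i0 * (mu W 1 * xi W 1 ^ n - mu W 2 * xi W 2 ^ n) / gm_det W i0"
    if "M + 1 \<le> n" "n \<le> i0" for n
  proof -
    have "visits W i0 n = high n" using that start by (auto simp: high_def)
    then show ?thesis using high_mu[of n] that lam_nz by (simp add: xM)
  qed
  moreover have "visits W i0 n = beta W i0 n * visits W i0 i0" if "i0 \<le> n" "n \<le> N - 1" for n
  proof -
    have "visits W i0 n = high n" using that start by (auto simp: high_def)
    then show ?thesis using high_beta[of n] high_i0 that by simp
  qed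
  moreover have "visits W i0 N = qr W S1 / qr W SN * beta W i0 N * visits W i0 i0" if "qr W SN \<noteq> 0"
  proof -
    have "visits W i0 N = qr W S1 / qr W SN * high N" using that pos by (simp add: high_def)
    then show ?thesis using high_beta[of N] high_i0 start by simp
  qed
  ultimately show ?thesis using summable xM by (intro conjI allI impI) (auto simp only:)
qed

end
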